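(* Let $D$ be an $n\times n$ unit spherical EDM of embedding dimension $r$ and let $1\le k<l\le n$. Let $(\tilde z^i)^T$ be the $i$th row of $\tilde Z$, where $\tilde Z=w$ if $r=n-1$ and $\tilde Z=[\,w\;\;Z\,]$ if $r\le n-2$. Assume that $\tilde z^k=\tilde z^l=0$, i.e., $w_k=w_l=0$ if $r=n-1$, and $w_k=w_l=0$ and $z^k=z^l=0$ if $r\le n-2$. Then $$T^{\leq}_{kl}=[\,\underline{\theta},\ \overline{\theta}\,],\qquad \underline{\theta}=\frac{2}{(s^k)^Ts^l-\|s^k\|\,\|s^l\|},\quad \overline{\theta}=\frac{2}{(s^k)^Ts^l+\|s^k\|\,\|s^l\|}.$$
   Context: An $n\times n$ real matrix $D=(d_{ij})$ is a Euclidean distance matrix (EDM) if there are points $p^1,\dots,p^n$ (generating points) in some Euclidean space with $d_{ij}=\|p^i-p^j\|^2$ for all $i,j$; the dimension of their affine span is the embedding dimension $r$ of $D$. $D$ is spherical of radius $\rho$ if its generating points, taken in $\mathbb{R}^r$, lie on a sphere of radius $\rho$ in $\mathbb{R}^r$ (equivalently, there is a scalar $\beta$ with $\beta ee^T-D\succeq 0$, and the smallest such $\beta$ is $2\rho^2$; $D=0$ counts as spherical of radius $0$). A unit spherical EDM is a spherical EDM of radius $1$. $e$ is the all-ones vector in $\mathbb{R}^n$, $M^\dagger$ is the Moore-Penrose inverse, and $w=D^\dagger e$ (so $Dw=e$). If $r\le n-2$, a Gale matrix $Z$ of $D$ is an $n\times(n-r-1)$ matrix whose columns form a basis of $\{x\in\mathbb{R}^n: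 P^Tx=0,\ e^Tx=0\}$, where $P$ is the $n\times r$ matrix whose rows are generating points of $D$ in $\mathbb{R}^r$; $(z^i)^T$ denotes the $i$th row of $Z$. Let $J=I-ee^T/n$ and $B=-\tfrac12 JDJ=PP^T$ with $P$ of size $n\times r$ and full column rank. Put $S=P(P^TP)^{-1}$ and let $(s^i)^T$ be the $i$th row of $S$ (so $SS^T=B^\dagger$ and $(s^i)^Ts^j=B^\dagger_{ij}$). $E^{kl}$ is the $n\times n$ symmetric matrix with $1$'s in positions $kl$ and $lk$ and zeros elsewhere. $T^{\leq}_{kl}$ is the set of real $t$ such that $D+tE^{kl}$ is a spherical EDM of radius $\rho\le 1$. *)

theory Defs
  imports "HOL-Analysis.Analysis"
begin

section \<open>Euclidean distance matrices\<close>

definition generates :: "real^'n^'n \<Rightarrow> ('n \<Rightarrow> 'a::euclidean_space) \<Rightarrow> bool" where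
  "generates D p \<longleftrightarrow> (\<forall>i j. D $ i $ j = (dist (p i) (p j))\<^sup>2)"

text \<open>
  A definition cannot quantify over the type of the ambient Euclidean space. As n points span at most
  n - 1 dimensions, n-dimensional space is used as the ambient space below; the lemmas
  \<open>generates_imp_edm\<close>, \<open>embedding_dim_eq\<close>, \<open>spherical_edm_iff\<close> and \<open>spherical_edm_iff_full_dim\<close>
  show that this choice, and the choice of the generating points, is immaterial.
\<close>

definition edm :: "real^'n^'n \<Rightarrow> bool" where
  "edm D \<longleftrightarrow> (\<exists>p :: 'n \<Rightarrow> real^'n. generates D p)"

definition embedding_dim :: "real^'n^'n \<Rightarrow> int" where
  "embedding_dim D = (THE r. \<exists>p :: 'n \<Rightarrow> real^'n. generates D p \<and> aff_dim (range p) = r)"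

text \<open>
  ``Points taken in r-dimensional space'': the sphere lives in the affine span of the points, so
  its centre has to lie there. (Otherwise points on a sphere of radius \<open>\<rho>\<close> would also lie on
  spheres of larger radius in a space with spare dimensions.)
\<close>

definition spherical_edm :: "real^'n^'n \<Rightarrow> real \<Rightarrow> bool" where
  "spherical_edm D \<rho> \<longleftrightarrow> (\<exists>p :: 'n \<Rightarrow> real^'n. generates D p \<and>
     (\<exists>c \<in> affine hull (range p). \<forall>i. dist c (p i) = \<rho>))"

abbreviation unit_spherical_edm :: "real^'n^'n \<Rightarrow> bool" where
  "unit_spherical_edm D \<equiv> spherical_edm D 1"

section \<open>Auxiliary matrices\<close>

definition ones :: "real^'n" where
  "ones = (\<chi> i. 1)"

definition J_mat :: "real^'n^'n" where
  "J_mat = mat 1 - (1 / real CARD('n)) *\<^sub>R (\<chi> i j. 1)"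

definition B_mat :: "real^'n^'n \<Rightarrow> real^'n^'n" where
  "B_mat D = (- 1 / 2) *\<^sub>R (J_mat ** D ** J_mat)"

definition S_mat :: "real^'r^'n \<Rightarrow> real^'r^'n" where
  "S_mat P = P ** matrix_inv (transpose P ** P)"

definition E_mat :: "'n \<Rightarrow> 'n \<Rightarrow> real^'n^'n" where
  "E_mat k l = (\<chi> i j. if i = k \<and> j = l \<or> i = l \<and> j = k then 1 else 0)"

definition is_pinv :: "real^'n^'m \<Rightarrow> real^'m^'n \<Rightarrow> bool" where
  "is_pinv M X \<longleftrightarrow> M ** X ** M = M \<and> X ** M ** X = X \<and>
     transpose (M ** X) = M ** X \<and> transpose (X ** M) = X ** M"

definition pinv :: "real^'n^'m \<Rightarrow> real^'m^'n" where
  "pinv M = (THE X. is_pinv M X)"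

text \<open>
  The rows of \<open>P\<close> are generating points in r-dimensional space, and \<open>Z\<close> has n - r - 1 columns; as
  index types are nonempty, this forces \<open>r \<le> n - 2\<close>.
\<close>

definition gale_matrix :: "real^'n^'n \<Rightarrow> real^'r^'n \<Rightarrow> real^'m^'n \<Rightarrow> bool" where
  "gale_matrix D P Z \<longleftrightarrow> embedding_dim D = int CARD('r) \<and> generates D (\<lambda>i. P $ i) \<and>
     CARD('m) + CARD('r) + 1 = CARD('n) \<and>
     inj (\<lambda>j. column j Z) \<and> independent (columns Z) \<and>
     span (columns Z) = {x. transpose P *v x = 0 \<and> ones \<bullet> x = 0}"

definition T_le :: "real^'n^'n \<Rightarrow> 'n \<Rightarrow> 'n \<Rightarrow> real set" where
  "T_le D k l = {t. \<exists>\<rho>\<le>1. spherical_edm (D + t *\<^sub>R E_mat k l) \<rho>}"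

section \<open>The definitions do not depend on the generating points or the ambient space\<close>

definition comb :: "('n::finite \<Rightarrow> 'a::euclidean_space) \<Rightarrow> 'n \<Rightarrow> real^'n \<Rightarrow> 'a" where
  "comb p a x = (\<Sum>i\<in>UNIV. (x $ i) *\<^sub>R (p i - p a))"

lemma linear_comb: "linear (comb p a)"
  unfolding comb_def
  by (intro linearI) (simp_all add: scaleR_left_distrib sum.distrib scaleR_sum_right)

lemma comb_axis: "comb p a (axis i 1) = p i - p a"
proof -
  have "comb p a (axis i 1) = (\<Sum>j\<in>UNIV. if j = i then p i - p a else 0)"
    unfolding comb_def by (intro sum.cong) (auto simp: axis_def)
  then show ?thesis by simp
qed

lemma range_comb: "range (comb p a) = span (range (\<lambda>i. p i - p a))"
proof
  show "range (comb p a) \<subseteq> span (range (\<lambda>i. p i - p a))"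
    unfolding comb_def by (blast intro: span_sum span_scale span_base)
  have "subspace (range (comb p a))"
    by (rule linear_subspace_image[OF linear_comb subspace_UNIV])
  moreover have "range (\<lambda>i. p i - p a) \<subseteq> range (comb p a)"
    by (intro image_subsetI) (rule range_eqI, rule comb_axis[symmetric])
  ultimately show "span (range (\<lambda>i. p i - p a)) \<subseteq> range (comb p a)"
    by (simp add: span_minimal)
qed

lemma generates_inner:
  assumes "generates D p"
  shows "(p i - p a) \<bullet> (p j - p a) = (D $ i $ a + D $ j $ a - D $ i $ j) / 2"
  using assms unfolding generates_def dist_norm
  by (simp add: power2_norm_eq_inner inner_diff inner_commute)

lemma norm_comb_eq:
  assumes "generates D p" "generates D q"
  shows "norm (comb p a x) = norm (comb q a x)"
  unfolding norm_eq_sqrt_inner comb_def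
  by (simp add: inner_sum_left inner_sum_right generates_inner[OF assms(1)] generates_inner[OF assms(2)])

lemma affine_hull_comb: "affine hull (range p) = (\<lambda>x. p a + comb p a x) ` UNIV"
proof -
  have "affine hull (range p) = (\<lambda>x. p a + x) ` span ((\<lambda>x. - p a + x) ` range p)"
    by (rule affine_hull_span_gen) (simp add: hull_inc)
  also have "(\<lambda>x. - p a + x) ` range p = range (\<lambda>i. p i - p a)"
    by auto
  finally show ?thesis
    by (auto simp: range_comb[symmetric])
qed

lemma aff_dim_comb: "aff_dim (range p) = int (dim (range (comb p a)))"
proof -
  have "aff_dim (range p) = int (dim ((\<lambda>x. x - p a) ` range p))"
    by (rule aff_dim_eq_dim_subtract) (simp add: hull_inc)
  then show ?thesis
    by (simp add: range_comb image_image)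
qed

lemma dim_comb_le:
  assumes "generates D p" "generates D q"
  shows "dim (range (comb q a)) \<le> dim (range (comb p a))"
proof -
  obtain g where g: "linear g" "\<And>v. v \<in> range (comb p a) \<Longrightarrow> comb p a (g v) = v"
    using linear_exists_right_inverse_on[OF linear_comb[of p a] subspace_UNIV] by metis
  have "comb q a x = comb q a (g (comb p a x))" for x
  proof -
    have "norm (comb q a (x - g (comb p a x))) = 0"
      using norm_comb_eq[OF assms, of a "x - g (comb p a x)"]
      by (simp add: linear_diff[OF linear_comb] g(2))
    then show ?thesis
      by (simp add: linear_diff[OF linear_comb])
  qed
  then have "range (comb q a) \<subseteq> (comb q a \<circ> g) ` range (comb p a)"
    by (auto intro!: image_eqI)
  then have "dim (range (comb q a)) \<le> dim ((comb q a \<circ> g) ` range (comb p a))"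
    by (rule dim_subset)
  also have "\<dots> \<le> dim (range (comb p a))"
    by (intro dim_image_le linear_compose g linear_comb)
  finally show ?thesis .
qed

lemma aff_dim_generates_eq:
  assumes "generates D p" "generates D q"
  shows "aff_dim (range p) = aff_dim (range q)"
proof -
  fix a
  have "dim (range (comb p a)) = dim (range (comb q a))"
    by (rule le_antisym) (rule dim_comb_le assms)+
  then show ?thesis
    using aff_dim_comb[of p a] aff_dim_comb[of q a] by presburger
qed

lemma generates_imp_edm:
  fixes D :: "real^'n::finite^'n" and p :: "'n::finite \<Rightarrow> 'a::euclidean_space"
  assumes "generates D p"
  shows "edm D"
proof -
  fix a :: 'n
  have "dim (range (comb p a)) \<le> dim (UNIV :: (real^'n) set)"
    by (intro dim_image_le linear_comb)
  moreover have "subspace (range (comb p a))"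
    by (simp add: range_comb)
  ultimately obtain f :: "'a \<Rightarrow> real^'n" where
    f: "linear f" "\<And>x. x \<in> range (comb p a) \<Longrightarrow> norm (f x) = norm x"
    using isometry_subset_subspace[of "range (comb p a)" UNIV] subspace_UNIV by metis
  have "dist (f (p i)) (f (p j)) = dist (p i) (p j)" for i j
  proof -
    have "p i - p j = comb p a (axis i 1 - axis j 1)"
      by (simp add: linear_diff[OF linear_comb] comb_axis)
    then show ?thesis
      using f by (metis dist_norm linear_diff rangeI)
  qed
  then have "generates D (\<lambda>i. f (p i))"
    using assms by (simp add: generates_def)
  then show ?thesis
    by (auto simp: edm_def)
qed

lemma embedding_dim_eq:
  assumes "generates D p"
  shows "embedding_dim D = aff_dim (range p)"
  unfolding embedding_dim_def
  using generates_imp_edm[OF assms] aff_dim_generates_eq[OF _ assms]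
  by (intro the_equality) (auto simp: edm_def)

lemma spherical_transfer:
  assumes "generates D p" "generates D q"
    and "\<exists>c \<in> affine hull (range p). \<forall>i. dist c (p i) = \<rho>"
  shows "\<exists>c \<in> affine hull (range q). \<forall>i. dist c (q i) = \<rho>"
proof -
  fix a
  obtain x where x: "\<And>i. dist (p a + comb p a x) (p i) = \<rho>"
    using assms(3) by (auto simp: affine_hull_comb[of p a])
  have dist_eq: "dist (f a + comb f a x) (f i) = norm (comb f a (x - axis i 1))"
    for f :: "'n::finite \<Rightarrow> 'z::euclidean_space" and a x i
    by (simp add: linear_diff[OF linear_comb] comb_axis dist_norm algebra_simps)
  have "dist (q a + comb q a x) (q i) = \<rho>" for i
    using x[of i] norm_comb_eq[OF assms(1,2)] unfolding dist_eq by simp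
  then show ?thesis
    by (auto simp: affine_hull_comb[of q a])
qed

lemma spherical_edm_iff:
  assumes "generates D p"
  shows "spherical_edm D \<rho> \<longleftrightarrow> (\<exists>c \<in> affine hull (range p). \<forall>i. dist c (p i) = \<rho>)"
proof
  assume "spherical_edm D \<rho>"
  then show "\<exists>c \<in> affine hull (range p). \<forall>i. dist c (p i) = \<rho>"
    using spherical_transfer[OF _ assms] unfolding spherical_edm_def by blast
next
  assume *: "\<exists>c \<in> affine hull (range p). \<forall>i. dist c (p i) = \<rho>"
  obtain q :: "'a \<Rightarrow> real^'a" where "generates D q"
    using generates_imp_edm[OF assms] by (auto simp: edm_def)
  with spherical_transfer[OF assms this *] show "spherical_edm D \<rho>"
    unfolding spherical_edm_def by blast
qed

lemma spherical_edm_iff_full_dim: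
  fixes p :: "'n::finite \<Rightarrow> 'a::euclidean_space"
  assumes "generates D p" "embedding_dim D = int DIM('a)"
  shows "spherical_edm D \<rho> \<longleftrightarrow> (\<exists>c. \<forall>i. dist c (p i) = \<rho>)"
proof -
  have "affine hull (range p) = UNIV"
    using assms by (simp add: embedding_dim_eq[OF assms(1)] aff_dim_eq_full)
  then show ?thesis
    by (simp add: spherical_edm_iff[OF assms(1)])
qed

section \<open>Existence and uniqueness of the Moore-Penrose inverse\<close>

lemma is_pinv_unique:
  assumes "is_pinv M X" "is_pinv M Y"
  shows "X = Y"
proof -
  have X: "M ** X ** M = M" "X ** M ** X = X" "transpose (M ** X) = M ** X" "transpose (X ** M) = X ** M"
    and Y: "M ** Y ** M = M" "Y ** M ** Y = Y" "transpose (M ** Y) = M ** Y" "transpose (Y ** M) = Y ** M"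
    using assms by (auto simp: is_pinv_def)
  have "M ** X = transpose (M ** Y ** M ** X)"
    using X Y by simp
  also have "\<dots> = (M ** X) ** (M ** Y)"
    using X(3) Y(3) by (metis matrix_mul_assoc matrix_transpose_mul)
  also have "\<dots> = M ** Y"
    by (simp add: matrix_mul_assoc X)
  finally have MX: "M ** X = M ** Y" .
  have "X ** M = transpose (X ** (M ** Y ** M))"
    using X Y by simp
  also have "\<dots> = (Y ** M) ** (X ** M)"
    using X(4) Y(4) by (metis matrix_mul_assoc matrix_transpose_mul)
  also have "\<dots> = Y ** (M ** X ** M)"
    by (simp add: matrix_mul_assoc)
  also have "\<dots> = Y ** M"
    by (simp add: X)
  finally have XM: "X ** M = Y ** M" .
  have "X = Y ** M ** X"
    using X XM by simp
  also have "\<dots> = Y ** M ** Y"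
    by (metis MX matrix_mul_assoc)
  finally show ?thesis
    using Y by simp
qed

lemma is_pinv_exists:
  fixes M :: "real^'n^'m"
  shows "\<exists>X. is_pinv M X"
proof -
  define R where "R = range ((*v) M)"
  define K where "K = {x. M *v x = 0}"
  have sR: "subspace R"
    unfolding R_def by (intro linear_subspace_image matrix_vector_mul_linear subspace_UNIV)
  have sK: "subspace K"
    unfolding K_def by (auto simp: subspace_def algebra_simps matrix_vector_mult_scaleR)
  define Q where "Q y x \<longleftrightarrow> (\<forall>v. (M *v x - y) \<bullet> (M *v v) = 0) \<and> (\<forall>v. M *v v = 0 \<longrightarrow> x \<bullet> v = 0)" for y x
  have ex: "\<exists>x. Q y x" for y
  proof -
    obtain y1 y2 where y: "y1 \<in> span R" "\<And>v. v \<in> span R \<Longrightarrow> orthogonal y2 v" "y = y1 + y2"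
      using orthogonal_subspace_decomp_exists[of R y] by metis
    then have "y1 \<in> R"
      using sR by (metis span_eq_iff)
    then obtain x where x: "y1 = M *v x"
      by (auto simp: R_def)
    obtain x1 x2 where xx: "x1 \<in> span K" "\<And>v. v \<in> span K \<Longrightarrow> orthogonal x2 v" "x = x1 + x2"
      using orthogonal_subspace_decomp_exists[of K x] by metis
    have "x1 \<in> K"
      using xx(1) sK by (metis span_eq_iff)
    then have M2: "M *v x2 = y1"
      using x xx(3) by (simp add: K_def algebra_simps)
    have "Q y x2"
      unfolding Q_def
    proof (intro conjI allI impI)
      fix v
      have "orthogonal y2 (M *v v)"
        by (intro y(2) span_base) (auto simp: R_def)
      then show "(M *v x2 - y) \<bullet> (M *v v) = 0"
        using y(3) M2 by (simp add: orthogonal_def)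
    next
      fix v assume "M *v v = 0"
      then show "x2 \<bullet> v = 0"
        using xx(2)[of v] by (auto simp: orthogonal_def K_def intro: span_base)
    qed
    then show ?thesis ..
  qed
  have uniq: "x = x'" if "Q y x" "Q y x'" for y x x'
  proof -
    have "(M *v (x - x')) \<bullet> (M *v (x - x')) = 0"
      using that unfolding Q_def by (simp add: algebra_simps inner_diff_left inner_diff_right)
    then have "M *v (x - x') = 0" by simp
    then have "x \<bullet> (x - x') = 0" "x' \<bullet> (x - x') = 0"
      using that unfolding Q_def by blast+
    then have "(x - x') \<bullet> (x - x') = 0"
      by (simp add: inner_diff_left)
    then show ?thesis by simp
  qed
  obtain f where f: "\<And>y. Q y (f y)"
    using ex by metis
  have "linear f"
  proof (rule linearI)
    show "f (y + z) = f y + f z" for y z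
    proof (rule uniq[OF f])
      have *: "M *v (f y + f z) - (y + z) = (M *v f y - y) + (M *v f z - z)"
        by (simp add: algebra_simps)
      show "Q (y + z) (f y + f z)"
        using f[of y] f[of z] unfolding Q_def * by (simp add: inner_add_left)
    qed
    show "f (c *\<^sub>R y) = c *\<^sub>R f y" for c y
    proof (rule uniq[OF f])
      have *: "M *v (c *\<^sub>R f y) - c *\<^sub>R y = c *\<^sub>R (M *v f y - y)"
        by (simp add: algebra_simps matrix_vector_mult_scaleR)
      show "Q (c *\<^sub>R y) (c *\<^sub>R f y)"
        using f[of y] unfolding Q_def * by simp
    qed
  qed
  define X where "X = matrix f"
  have Xv: "X *v y = f y" for y
    using \<open>linear f\<close> by (simp add: X_def matrix_works)
  have fM: "M *v f (M *v v) = M *v v" for v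
  proof -
    have "(M *v (f (M *v v) - v)) \<bullet> (M *v (f (M *v v) - v)) = 0"
      using f[of "M *v v"] unfolding Q_def by (metis matrix_vector_mult_diff_distrib)
    then show ?thesis
      by (simp add: matrix_vector_mult_diff_distrib)
  qed
  have fMf: "f (M *v f y) = f y" for y
    by (rule uniq[OF f]) (use f[of y] in \<open>simp add: Q_def\<close>)
  have sym: "transpose A = A" if "\<And>u v. (A *v u) \<bullet> v = u \<bullet> (A *v v)" for A :: "real^'z^'z"
  proof -
    have "(transpose A *v u) \<bullet> v = (A *v u) \<bullet> v" for u v
      using that[of u v] by (simp add: transpose_matrix_vector dot_lmul_matrix)
    then have "transpose A *v u = A *v u" for u
      using vector_eq_rdot by blast
    then show ?thesis
      by (simp add: matrix_eq del: transpose_matrix_vector)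
  qed
  have "M ** X ** M = M" "X ** M ** X = X"
    unfolding matrix_eq by (simp_all add: matrix_vector_mul_assoc[symmetric] Xv fM fMf)
  moreover have "transpose (M ** X) = M ** X"
  proof (rule sym)
    fix u v
    have "(M *v f u - u) \<bullet> (M *v f v) = 0" "(M *v f v - v) \<bullet> (M *v f u) = 0"
      using f[of u] f[of v] unfolding Q_def by blast+
    then have "(M *v f u) \<bullet> v = u \<bullet> (M *v f v)"
      unfolding inner_diff_left
      using inner_commute[of v "M *v f u"] inner_commute[of "M *v f v" "M *v f u"] by linarith
    then show "((M ** X) *v u) \<bullet> v = u \<bullet> ((M ** X) *v v)"
      by (simp add: matrix_vector_mul_assoc[symmetric] Xv)
  qed
  moreover have "transpose (X ** M) = X ** M"
  proof (rule sym)
    fix u v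
    have *: "f y \<bullet> v = f y \<bullet> f (M *v v)" for v y
    proof -
      have "M *v (v - f (M *v v)) = 0"
        by (simp add: matrix_vector_mult_diff_distrib fM)
      then have "f y \<bullet> (v - f (M *v v)) = 0"
        using f[of y] unfolding Q_def by blast
      then show ?thesis by (simp add: inner_diff_right)
    qed
    show "((X ** M) *v u) \<bullet> v = u \<bullet> ((X ** M) *v v)"
      using *[of "M *v u" v] *[of "M *v v" u]
      by (simp add: matrix_vector_mul_assoc[symmetric] Xv inner_commute)
  qed
  ultimately show ?thesis
    unfolding is_pinv_def by blast
qed

lemma is_pinv_pinv: "is_pinv M (pinv M)"
  unfolding pinv_def by (rule theI') (metis is_pinv_exists is_pinv_unique)

end

(* Translate the points so that the centre of the unit sphere is the origin; let U have the points
   u i as rows, so D = 2 (e e^T - U U^T). The vector w and the columns of Z span the kernel of U^T,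
   so the hypothesis makes this kernel orthogonal to the k-th and l-th unit vectors. These therefore
   are U a and U b for some a, b, which turn out to be S $ k and S $ l. A matrix D' with zero
   diagonal is a spherical EDM of radius at most 1 iff 2 e e^T - D' is positive semidefinite;
   for D' = D + t E this means U (I - (t/2) (a b^T + b a^T)) U^T is, and since a b^T + b a^T has
   the extreme eigenvalues a . b - |a| |b| < 0 < a . b + |a| |b|, that t lies in the interval. *)

theory Submission
  imports Defs
begin

section \<open>Quadratic forms of spherical distance matrices\<close>

text \<open>Seen from \<open>c\<close>, the points have norm \<rho>, so an entry of \<open>D\<close>
  is 2 \<rho>^2 minus twice an inner product. Hence 2 \<rho>^2 e e^T - D is positive semidefinite;
  applied to a matrix and to its perturbation, the formula gives the necessity of the bounds on
  t.\<close>

lemma sum_sum_dist_sphere: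
  fixes p :: "'n::finite \<Rightarrow> 'a::euclidean_space"
  assumes "generates D p" "\<And>i. dist c (p i) = \<rho>"
  shows "(\<Sum>i\<in>UNIV. \<Sum>j\<in>UNIV. x i * x j * D $ i $ j) =
    2 * \<rho>\<^sup>2 * (\<Sum>i\<in>UNIV. x i)\<^sup>2 - 2 * (norm (\<Sum>i\<in>UNIV. x i *\<^sub>R (p i - c)))\<^sup>2"
proof -
  have D: "D $ i $ j = 2 * \<rho>\<^sup>2 - 2 * ((p i - c) \<bullet> (p j - c))" for i j
  proof -
    have "norm (p i - c) = \<rho>" for i
      using assms(2)[of i] by (metis dist_commute dist_norm)
    moreover have "D $ i $ j = (norm ((p i - c) - (p j - c)))\<^sup>2"
      using assms(1) by (simp add: generates_def dist_norm)
    ultimately show ?thesis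
      using dot_norm_neg[of "p i - c" "p j - c"] by simp
  qed
  have "(norm (\<Sum>i\<in>UNIV. x i *\<^sub>R (p i - c)))\<^sup>2
      = (\<Sum>i\<in>UNIV. \<Sum>j\<in>UNIV. x i * x j * ((p i - c) \<bullet> (p j - c)))"
    unfolding power2_norm_eq_inner inner_sum_left
    by (simp add: inner_sum_right sum_distrib_left mult_ac)
  moreover have "(\<Sum>i\<in>UNIV. x i)\<^sup>2 = (\<Sum>i\<in>UNIV. \<Sum>j\<in>UNIV. x i * x j)"
    by (simp add: power2_eq_square sum_product)
  moreover have "x i * x j * D $ i $ j
      = 2 * \<rho>\<^sup>2 * (x i * x j) - 2 * (x i * x j * ((p i - c) \<bullet> (p j - c)))" for i j
    unfolding D by (simp only: right_diff_distrib mult_ac)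
  ultimately show ?thesis
    by (simp only: sum_subtractf sum_distrib_left)
qed

lemma sum_sum_E_mat:
  assumes "k \<noteq> l"
  shows "(\<Sum>i\<in>UNIV. \<Sum>j\<in>UNIV. x i * x j * E_mat k l $ i $ j) = 2 * x k * x l"
proof -
  have "x i * x j * E_mat k l $ i $ j =
      (if i = k then (if j = l then x k * x l else 0) else 0) +
      (if i = l then (if j = k then x k * x l else 0) else 0)" for i j
    using assms by (auto simp: E_mat_def)
  moreover have "(\<Sum>j\<in>UNIV. (if i = k then (if j = l then x k * x l else 0) else 0)) =
      (if i = k then x k * x l else 0)"
    "(\<Sum>j\<in>UNIV. (if i = l then (if j = k then x k * x l else 0) else 0)) =
      (if i = l then x k * x l else 0)" for i
    by simp_all
  ultimately show ?thesis
    by (simp add: sum.distrib)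
qed

text \<open>The centre is the point of the affine span closest to the origin.\<close>

lemma spherical_edm_unit_vectors:
  fixes v :: "'n::finite \<Rightarrow> 'a::euclidean_space"
  assumes "generates D v" "\<And>i. norm (v i) = 1"
  shows "\<exists>\<rho>\<le>1. spherical_edm D \<rho>"
proof -
  fix a :: 'n
  let ?A = "range (comb v a)"
  have sp: "span ?A = ?A"
    by (simp add: range_comb)
  obtain y c where y: "y \<in> ?A" "\<And>z. z \<in> ?A \<Longrightarrow> orthogonal c z" "v a = y + c"
    using orthogonal_subspace_decomp_exists[of ?A "v a"] unfolding sp by metis
  have "- y \<in> ?A"
    using y(1) by (metis sp span_neg)
  then obtain x where "c = v a + comb v a x"
    using y(3) by (metis rangeE add.commute add_diff_cancel_right' diff_conv_add_uminus add_diff_cancel_left')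
  then have c: "c \<in> affine hull (range v)"
    by (auto simp: affine_hull_comb[of v a])
  \<comment> \<open>\<open>c\<close> is orthogonal to all directions of the affine span, so
    Pythagoras gives every point the squared distance 1 - c . c.\<close>
  have "dist c (v i) = sqrt (1 - c \<bullet> c)" for i
  proof -
    have "v i - c = comb v a (axis i 1) + y"
      using y(3) by (simp add: comb_axis)
    then have "v i - c \<in> ?A"
      using y(1) by (metis sp span_add rangeI)
    then have "c \<bullet> (v i - c) = 0"
      using y(2) by (simp add: orthogonal_def)
    moreover have "v i \<bullet> v i = 1"
      using assms(2)[of i] by (simp add: norm_eq_1)
    ultimately show ?thesis
      by (simp add: dist_norm norm_eq_sqrt_inner inner_diff_left inner_diff_right inner_commute)
  qed
  then have "spherical_edm D (sqrt (1 - c \<bullet> c))"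
    using c spherical_edm_iff[OF assms(1)] by blast
  moreover have "sqrt (1 - c \<bullet> c) \<le> 1"
    by simp
  ultimately show ?thesis
    by blast
qed

section \<open>Square roots of perturbations of the identity\<close>

text \<open>For a vector p with p . p = P, the map I + \<beta> p p^T is then a square root of I -
  \<alpha> p p^T. The witness makes p an eigenvector with eigenvalue sqrt (1 - \<alpha> P), which is
  real by the second assumption.\<close>

lemma rank_one_square_root:
  fixes P \<alpha> :: real
  assumes "P > 0" "\<alpha> * P \<le> 1"
  obtains \<beta> where "2 * \<beta> + \<beta>\<^sup>2 * P = - \<alpha>"
proof
  define s where "s = sqrt (1 - \<alpha> * P)"
  have "s\<^sup>2 = 1 - \<alpha> * P"
    using assms by (simp add: s_def)
  moreover have "2 * ((s - 1) / P) + ((s - 1) / P)\<^sup>2 * P = (s\<^sup>2 - 1) / P"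
    using assms(1) by (simp add: field_simps power2_eq_square)
  ultimately show "2 * ((s - 1) / P) + ((s - 1) / P)\<^sup>2 * P = - \<alpha>"
    using assms(1) by simp
qed

text \<open>
  The map is the symmetric square root of \<open>I - (t/2) (a b\<^sup>T + b a\<^sup>T)\<close>, whose nontrivial eigenvectors
  are \<open>a/\<parallel>a\<parallel> \<plusminus> b/\<parallel>b\<parallel>\<close>.
\<close>

lemma rank_two_square_root:
  fixes a b :: "'a::euclidean_space"
  assumes ab: "\<bar>a \<bullet> b\<bar> < norm a * norm b"
    and t: "t * (a \<bullet> b + norm a * norm b) \<le> 2" "t * (a \<bullet> b - norm a * norm b) \<le> 2"
  obtains f :: "'a \<Rightarrow> 'a" where
    "\<And>x y. f x \<bullet> f y = x \<bullet> y - t / 2 * ((a \<bullet> x) * (b \<bullet> y) + (b \<bullet> x) * (a \<bullet> y))"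
proof -
  define A where "A = norm a"
  define B where "B = norm b"
  have "a \<noteq> 0" "b \<noteq> 0"
    using ab by auto
  then have AB: "A > 0" "B > 0"
    by (auto simp: A_def B_def)
  have aa: "a \<bullet> a = A\<^sup>2" "b \<bullet> b = B\<^sup>2"
    by (simp_all add: A_def B_def power2_norm_eq_inner)
  define p where "p = (1 / A) *\<^sub>R a + (1 / B) *\<^sub>R b"
  define q where "q = (1 / A) *\<^sub>R a - (1 / B) *\<^sub>R b"
  have pp: "p \<bullet> p = 2 * (A * B + a \<bullet> b) / (A * B)" and qq: "q \<bullet> q = 2 * (A * B - a \<bullet> b) / (A * B)"
    and pq: "p \<bullet> q = 0" "q \<bullet> p = 0"
    using AB by (simp_all add: p_def q_def inner_add_left inner_add_right inner_diff_left
        inner_diff_right aa inner_commute[of b a] field_simps power2_eq_square)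
  \<comment> \<open>The scaling is chosen so that (t/2) (a b^T + b a^T) = \<alpha> (p p^T - q q^T).
    As \<open>p\<close> and \<open>q\<close> are orthogonal, the root can be taken in each direction
    separately.\<close>
  define \<alpha> where "\<alpha> = t * A * B / 4"
  have pos: "p \<bullet> p > 0" "q \<bullet> q > 0"
    using ab AB unfolding pp qq A_def B_def by (auto simp: abs_less_iff)
  \<comment> \<open>The bounds on t say that the eigenvalues 1 - \<alpha> (p . p) and 1 + \<alpha>
    (q . q) are nonnegative.\<close>
  have "\<alpha> * (p \<bullet> p) = t * (a \<bullet> b + A * B) / 2" "(- \<alpha>) * (q \<bullet> q) = t * (a \<bullet> b - A * B) / 2"
    using AB by (simp_all add: pp qq \<alpha>_def field_simps)
  then have "\<alpha> * (p \<bullet> p) \<le> 1" "(- \<alpha>) * (q \<bullet> q) \<le> 1"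
    using t by (simp_all add: A_def B_def)
  then obtain \<beta> \<gamma> where \<beta>: "2 * \<beta> + \<beta>\<^sup>2 * (p \<bullet> p) = - \<alpha>" and \<gamma>: "2 * \<gamma> + \<gamma>\<^sup>2 * (q \<bullet> q) = \<alpha>"
    using rank_one_square_root pos by (metis minus_minus)
  define f where "f x = x + (\<beta> * (p \<bullet> x)) *\<^sub>R p + (\<gamma> * (q \<bullet> x)) *\<^sub>R q" for x
  have "f x \<bullet> f y = x \<bullet> y - t / 2 * ((a \<bullet> x) * (b \<bullet> y) + (b \<bullet> x) * (a \<bullet> y))" for x y
  proof -
    have "f x \<bullet> f y = x \<bullet> y + (2 * \<beta> + \<beta>\<^sup>2 * (p \<bullet> p)) * (p \<bullet> x) * (p \<bullet> y)
        + (2 * \<gamma> + \<gamma>\<^sup>2 * (q \<bullet> q)) * (q \<bullet> x) * (q \<bullet> y)"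
      by (simp add: f_def inner_add_left inner_add_right pq inner_commute[of x p]
        inner_commute[of x q] algebra_simps power2_eq_square)
    also have "\<dots> = x \<bullet> y - \<alpha> * ((p \<bullet> x) * (p \<bullet> y) - (q \<bullet> x) * (q \<bullet> y))"
      unfolding \<beta> \<gamma> by (simp add: algebra_simps)
    also have "(p \<bullet> x) * (p \<bullet> y) - (q \<bullet> x) * (q \<bullet> y) =
        2 * ((a \<bullet> x) * (b \<bullet> y) + (b \<bullet> x) * (a \<bullet> y)) / (A * B)"
      using AB by (simp add: p_def q_def inner_add_left inner_diff_left field_simps)
    finally show ?thesis
      using AB by (simp add: \<alpha>_def)
  qed
  then show thesis
    by (rule that)
qed

section \<open>The interval, for points with dual vectors\<close>

text \<open>On the points, a b^T + b a^T takes the values of \<open>E_mat k l\<close>, so the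
  question is when I - (t/2) (a b^T + b a^T) is positive semidefinite. If it is, its square root
  moves the points to unit vectors generating the perturbed matrix; conversely, testing the two
  extreme eigenvectors bounds t.\<close>

lemma T_le_dual_vectors:
  fixes u :: "'n::finite \<Rightarrow> 'a::euclidean_space"
  assumes D: "generates D u" and u1: "\<And>i. norm (u i) = 1"
    and span: "span (range u) = UNIV" and kl: "k \<noteq> l"
    and a: "\<And>i. a \<bullet> u i = (if i = k then 1 else 0)"
    and b: "\<And>i. b \<bullet> u i = (if i = l then 1 else 0)"
  shows "T_le D k l = {2 / (a \<bullet> b - norm a * norm b) .. 2 / (a \<bullet> b + norm a * norm b)}"
proof -
  let ?A = "norm a" and ?B = "norm b"
  have nz: "a \<noteq> 0" "b \<noteq> 0"
    using a[of k] b[of l] by auto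
  \<comment> \<open>Equality in Cauchy-Schwarz would make \<open>a\<close> and \<open>b\<close>
    parallel, but \<open>u k\<close> is orthogonal to \<open>b\<close> and not to
    \<open>a\<close>.\<close>
  have "\<bar>a \<bullet> b\<bar> \<noteq> ?A * ?B"
  proof
    assume "\<bar>a \<bullet> b\<bar> = ?A * ?B"
    then have "?A *\<^sub>R b = ?B *\<^sub>R a \<or> ?A *\<^sub>R b = - ?B *\<^sub>R a"
      using norm_cauchy_schwarz_abs_eq by blast
    then show False
    proof
      assume "?A *\<^sub>R b = ?B *\<^sub>R a"
      then have "(?A *\<^sub>R b) \<bullet> u k = (?B *\<^sub>R a) \<bullet> u k"
        by (rule arg_cong)
      then show False
        using kl nz by (simp add: a b)
    next
      assume "?A *\<^sub>R b = - ?B *\<^sub>R a"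
      then have "(?A *\<^sub>R b) \<bullet> u k = (- ?B *\<^sub>R a) \<bullet> u k"
        by (rule arg_cong)
      then show False
        using kl nz by (simp add: a b)
    qed
  qed
  then have ab: "\<bar>a \<bullet> b\<bar> < ?A * ?B"
    using Cauchy_Schwarz_ineq2[of a b] by linarith
  \<comment> \<open>The denominators have opposite signs, so clearing the negative one turns the
    lower endpoint into the second upper bound.\<close>
  have interval: "t \<in> {2 / (a \<bullet> b - ?A * ?B) .. 2 / (a \<bullet> b + ?A * ?B)} \<longleftrightarrow>
      t * (a \<bullet> b + ?A * ?B) \<le> 2 \<and> t * (a \<bullet> b - ?A * ?B) \<le> 2" for t
  proof -
    have "a \<bullet> b - ?A * ?B < 0" "a \<bullet> b + ?A * ?B > 0"
      using ab by linarith+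
    then show ?thesis
      by (auto simp: pos_le_divide_eq neg_divide_le_eq)
  qed
  have "t \<in> T_le D k l" if t: "t * (a \<bullet> b + ?A * ?B) \<le> 2" "t * (a \<bullet> b - ?A * ?B) \<le> 2" for t
  proof -
    obtain f :: "'a \<Rightarrow> 'a" where
      f: "\<And>x y. f x \<bullet> f y = x \<bullet> y - t / 2 * ((a \<bullet> x) * (b \<bullet> y) + (b \<bullet> x) * (a \<bullet> y))"
      using rank_two_square_root[OF ab t] by blast
    have fu: "f (u i) \<bullet> f (u j) = u i \<bullet> u j - t / 2 * E_mat k l $ i $ j" for i j
      using kl by (auto simp: f a b E_mat_def)
    have diag: "E_mat k l $ i $ i = 0" for i
      using kl by (simp add: E_mat_def)
    have "u i \<bullet> u i = 1" for i
      using u1[of i] by (simp add: norm_eq_1)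
    then have fu1: "norm (f (u i)) = 1" for i
      by (simp add: norm_eq_1 fu diag)
    have "(D + t *\<^sub>R E_mat k l) $ i $ j = (norm (f (u i) - f (u j)))\<^sup>2" for i j
    proof -
      have "(norm (u i - u j))\<^sup>2 = 2 - 2 * (u i \<bullet> u j)"
        using dot_norm_neg[of "u i" "u j"] by (simp add: u1)
      moreover have "(norm (f (u i) - f (u j)))\<^sup>2 = 2 - 2 * (f (u i) \<bullet> f (u j))"
        using dot_norm_neg[of "f (u i)" "f (u j)"] by (simp add: fu1)
      ultimately show ?thesis
        using D by (simp add: generates_def dist_norm fu)
    qed
    then have "generates (D + t *\<^sub>R E_mat k l) (\<lambda>i. f (u i))"
      by (simp add: generates_def dist_norm)
    then show ?thesis
      unfolding T_le_def using spherical_edm_unit_vectors fu1 by blast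
  qed
  moreover have "t * (a \<bullet> b + ?A * ?B) \<le> 2 \<and> t * (a \<bullet> b - ?A * ?B) \<le> 2" if t: "t \<in> T_le D k l" for t
  proof -
    obtain \<rho> and p :: "'n \<Rightarrow> real^'n" and c where
      \<rho>: "\<rho> \<le> 1" and p: "generates (D + t *\<^sub>R E_mat k l) p" "\<And>i. dist c (p i) = \<rho>"
      using t unfolding T_le_def spherical_edm_def by blast
    have "\<rho> \<ge> 0"
      using p(2) zero_le_dist by metis
    then have \<rho>2: "\<rho>\<^sup>2 \<le> 1"
      using \<rho> by (simp add: power_le_one)
    \<comment> \<open>This is positive semidefiniteness of I - (t/2) (a b^T + b a^T). With
      \<open>y\<close> a combination of the points, a . y and b . y are its coefficients at k and l.
      The quadratic form of the perturbed matrix is computed in two ways; the squared norm is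
      dropped and \<rho> <= 1 is used.\<close>
    have quad: "t * (a \<bullet> y) * (b \<bullet> y) \<le> y \<bullet> y" for y
    proof -
      have "y \<in> span (range u)"
        by (simp add: span)
      then obtain r where r: "y = (\<Sum>z\<in>range u. r z *\<^sub>R z)"
        by (auto simp: span_finite)
      \<comment> \<open>Distinct indices may carry the same point. \<open>g\<close> picks one index
        per point, and all other indices get coefficient 0, so that a sum over points becomes a sum
        over indices.\<close>
      define g where "g z = (SOME i. u i = z)" for z
      have g: "u (g z) = z" if "z \<in> range u" for z
        using that unfolding g_def by (metis (mono_tags, lifting) rangeE someI)
      define x where "x i = (if i \<in> g ` range u then r (u i) else 0)" for i
      have y: "y = (\<Sum>i\<in>UNIV. x i *\<^sub>R u i)"
      proof -
        have "inj_on g (range u)"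
          using g by (metis inj_onI)
        then have "(\<Sum>i\<in>g ` range u. r (u i) *\<^sub>R u i) = y"
          unfolding r by (subst sum.reindex) (auto simp: g intro!: sum.cong)
        moreover have "(\<Sum>i\<in>UNIV. x i *\<^sub>R u i) = (\<Sum>i\<in>g ` range u. r (u i) *\<^sub>R u i)"
          by (rule sum.mono_neutral_cong_right) (auto simp: x_def)
        ultimately show ?thesis by simp
      qed
      have ay: "a \<bullet> y = x k" "b \<bullet> y = x l"
        unfolding y by (simp_all add: inner_sum_right a b if_distrib cong: if_cong)
      have "2 * \<rho>\<^sup>2 * (\<Sum>i\<in>UNIV. x i)\<^sup>2 - 2 * (norm (\<Sum>i\<in>UNIV. x i *\<^sub>R (p i - c)))\<^sup>2
          = (\<Sum>i\<in>UNIV. \<Sum>j\<in>UNIV. x i * x j * (D + t *\<^sub>R E_mat k l) $ i $ j)"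
        using sum_sum_dist_sphere[OF p] by simp
      also have "\<dots> = (\<Sum>i\<in>UNIV. \<Sum>j\<in>UNIV. x i * x j * D $ i $ j)
          + t * (\<Sum>i\<in>UNIV. \<Sum>j\<in>UNIV. x i * x j * E_mat k l $ i $ j)"
        by (simp add: sum_distrib_left sum.distrib[symmetric] algebra_simps)
      also have "\<dots> = 2 * (\<Sum>i\<in>UNIV. x i)\<^sup>2 - 2 * (y \<bullet> y) + 2 * t * x k * x l"
        using sum_sum_dist_sphere[OF D, of 0 1 x] u1
        by (simp add: y[symmetric] sum_sum_E_mat[OF kl] power2_norm_eq_inner)
      finally have "2 * t * x k * x l \<le> 2 * (y \<bullet> y) + 2 * (\<rho>\<^sup>2 * (\<Sum>i\<in>UNIV. x i)\<^sup>2 - (\<Sum>i\<in>UNIV. x i)\<^sup>2)"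
        by (simp add: algebra_simps)
      moreover have "\<rho>\<^sup>2 * (\<Sum>i\<in>UNIV. x i)\<^sup>2 \<le> (\<Sum>i\<in>UNIV. x i)\<^sup>2"
        using \<rho>2 by (simp add: mult_left_le_one_le)
      ultimately show ?thesis
        unfolding ay by (simp add: mult_ac)
    qed
    have aa: "a \<bullet> a = ?A\<^sup>2" "b \<bullet> b = ?B\<^sup>2"
      by (simp_all add: power2_norm_eq_inner)
    have main: "t * (a \<bullet> b + \<sigma> * ?A * ?B) \<le> 2" if \<sigma>: "\<sigma> = 1 \<or> \<sigma> = -1" for \<sigma> :: real
    proof -
      \<comment> \<open>\<open>?y\<close> is a multiple of a/|a| + \<sigma> b/|b|, an eigenvector of
        a b^T + b a^T with eigenvalue \<sigma> \<open>?h\<close>.\<close>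
      let ?h = "?A * ?B + \<sigma> * (a \<bullet> b)"
      let ?y = "?B *\<^sub>R a + (\<sigma> * ?A) *\<^sub>R b"
      have "?h > 0"
        using \<sigma> ab by (auto simp: abs_less_iff)
      have AB: "?A * ?B > 0"
        using nz by simp
      have ay: "a \<bullet> ?y = ?A * ?h"
        by (simp add: inner_add_right aa algebra_simps power2_eq_square)
      have by': "b \<bullet> ?y = \<sigma> * ?B * ?h"
        using \<sigma> by (auto simp: inner_add_right aa algebra_simps power2_eq_square inner_commute)
      have "?y \<bullet> ?y = ?B * (a \<bullet> ?y) + \<sigma> * ?A * (b \<bullet> ?y)"
        by (simp only: inner_add_left inner_scaleR_left)
      also have "\<dots> = 2 * (?A * ?B * ?h)"
        unfolding ay by' using \<sigma> by auto
      finally have yy: "?y \<bullet> ?y = 2 * (?A * ?B * ?h)" .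
      have "t * (?A * ?h) * (\<sigma> * ?B * ?h) \<le> 2 * (?A * ?B * ?h)"
        using quad[of ?y] unfolding ay by' yy .
      then have "(t * (\<sigma> * ?h)) * (?A * ?B * ?h) \<le> 2 * (?A * ?B * ?h)"
        by (simp only: mult_ac)
      then have "t * (\<sigma> * ?h) \<le> 2"
        using AB \<open>?h > 0\<close> mult_le_cancel_right_pos by (meson mult_pos_pos)
      moreover have "\<sigma> * ?h = a \<bullet> b + \<sigma> * ?A * ?B"
        using \<sigma> by auto
      ultimately show ?thesis
        by simp
    qed
    show ?thesis
      using main[of 1] main[of "-1"] by simp
  qed
  ultimately show ?thesis
    using interval by blast
qed

section \<open>Centred generating points, dual vectors and the rows of \<open>S_mat\<close>\<close>

text \<open>Double centring subtracts the row and column means \<open>R\<close> and adds the overall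
  mean \<open>m\<close>. These terms cancel in squared distances, which leaves \<open>D\<close>, and
  they make every column of P P^T sum to 0, so the sum of the points is orthogonal to each
  point.\<close>

lemma generates_of_B_mat:
  fixes D :: "real^'n^'n" and P :: "real^'r^'n"
  assumes "edm D" "B_mat D = P ** transpose P"
  shows "generates D (\<lambda>i. P $ i)" "(\<Sum>i\<in>UNIV. P $ i) = 0"
proof -
  obtain p :: "'n \<Rightarrow> real^'n" where p: "generates D p"
    using assms(1) by (auto simp: edm_def)
  have sym: "D $ i $ j = D $ j $ i" and diag: "D $ i $ i = 0" for i j
    using p by (simp_all add: generates_def dist_commute)
  define n where "n = real CARD('n)"
  have n: "n > 0"
    by (simp add: n_def)
  have J: "J_mat $ i $ j = (if i = j then 1 else 0) - 1 / n" for i j :: 'n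
    by (simp add: J_mat_def mat_def n_def)
  have sumJ: "(\<Sum>m\<in>UNIV. J_mat $ i $ m) = 0" for i :: 'n
    using n by (simp add: J sum_subtractf n_def)
  define R where "R i = (\<Sum>j\<in>UNIV. D $ i $ j) / n" for i
  define m where "m = (\<Sum>i\<in>UNIV. R i) / n"
  have DJ: "(J_mat ** D) $ i $ j = D $ i $ j - R j" for i j
  proof -
    have "(J_mat ** D) $ i $ j = (\<Sum>k\<in>UNIV. (if i = k then D $ k $ j else 0) - D $ k $ j / n)"
      unfolding matrix_matrix_mult_def by (auto simp: J algebra_simps intro!: sum.cong)
    then show ?thesis
      by (simp add: sum_subtractf R_def sum_divide_distrib sym[of j])
  qed
  have JDJ: "(J_mat ** D ** J_mat) $ i $ j = D $ i $ j - R j - R i + m" for i j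
  proof -
    have "(J_mat ** D ** J_mat) $ i $ j = (\<Sum>k\<in>UNIV. (D $ i $ k - R k) * J_mat $ k $ j)"
      unfolding matrix_matrix_mult_def[of "J_mat ** D"] by (simp add: DJ)
    also have "\<dots> = (\<Sum>k\<in>UNIV. (if k = j then D $ i $ k - R k else 0) - (D $ i $ k - R k) / n)"
      by (auto simp: J right_diff_distrib intro!: sum.cong)
    also have "\<dots> = D $ i $ j - R j - ((\<Sum>k\<in>UNIV. D $ i $ k) / n - (\<Sum>k\<in>UNIV. R k) / n)"
      by (simp add: sum_subtractf diff_divide_distrib sum_divide_distrib)
    finally show ?thesis
      by (simp add: R_def m_def)
  qed
  have PP: "P $ i \<bullet> P $ j = - (D $ i $ j - R j - R i + m) / 2" for i j
  proof -
    have "P $ i \<bullet> P $ j = (P ** transpose P) $ i $ j"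
      by (simp add: matrix_matrix_mult_def transpose_def inner_vec_def)
    also have "\<dots> = - (D $ i $ j - R j - R i + m) / 2"
      by (simp only: assms(2)[symmetric] B_mat_def vector_scaleR_component JDJ real_scaleR_def)
    finally show ?thesis .
  qed
  show "generates D (\<lambda>i. P $ i)"
    unfolding generates_def dist_norm power2_norm_eq_inner
    by (simp add: inner_diff_left inner_diff_right PP diag sym field_simps)
  have "(\<Sum>i\<in>UNIV. P $ i) \<bullet> P $ j = 0" for j
  proof -
    have "(\<Sum>i\<in>UNIV. D $ i $ j) = n * R j" "(\<Sum>i\<in>UNIV. R i) = n * m"
      using n by (simp_all add: R_def m_def sym[of _ j])
    then show ?thesis
      by (simp add: inner_sum_left PP sum_divide_distrib[symmetric] sum_negf sum.distrib
          sum_subtractf n_def[symmetric])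
  qed
  then have "(\<Sum>i\<in>UNIV. P $ i) \<bullet> (\<Sum>i\<in>UNIV. P $ i) = 0"
    by (simp add: inner_sum_right)
  then show "(\<Sum>i\<in>UNIV. P $ i) = 0"
    by simp
qed

lemma transpose_mult_eq_sum_rows:
  fixes P :: "real^'r^'n"
  shows "transpose P *v x = (\<Sum>i\<in>UNIV. x $ i *\<^sub>R P $ i)"
  by (simp add: vec_eq_iff matrix_vector_mult_def transpose_def mult.commute)

text \<open>The range of \<open>U\<close> is the orthogonal complement of the linear relations among
  the points. The assumption puts the m-th unit vector there, and a preimage under \<open>U\<close>
  is the dual vector.\<close>

lemma dual_vector_exists:
  fixes u :: "'n::finite \<Rightarrow> 'a::euclidean_space"
  assumes "\<And>x :: real^'n. (\<Sum>i\<in>UNIV. x $ i *\<^sub>R u i) = 0 \<Longrightarrow> x $ m = 0"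
  obtains a where "\<And>i. a \<bullet> u i = (if i = m then 1 else 0)"
proof -
  define U where "U a = (\<chi> i. a \<bullet> u i)" for a
  have "linear U"
    by (intro linearI) (simp_all add: U_def vec_eq_iff inner_add_left)
  then have "subspace (range U)"
    by (intro linear_subspace_image subspace_UNIV)
  then have sp: "span (range U) = range U"
    by simp
  obtain z y where zy: "z \<in> range U" "\<And>v. v \<in> range U \<Longrightarrow> orthogonal y v" "axis m 1 = z + y"
    using orthogonal_subspace_decomp_exists[of "range U" "axis m 1"] unfolding sp by metis
  \<comment> \<open>By this adjointness the residual \<open>y\<close> is itself a relation, so its
    m-th entry vanishes; then y . y = y_m - y . z = 0.\<close>
  have inner_U: "y \<bullet> U a = a \<bullet> (\<Sum>i\<in>UNIV. y $ i *\<^sub>R u i)" for a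
    by (simp add: U_def inner_vec_def inner_sum_right)
  have "(\<Sum>i\<in>UNIV. y $ i *\<^sub>R u i) \<bullet> (\<Sum>i\<in>UNIV. y $ i *\<^sub>R u i) = 0"
    using zy(2) by (simp add: inner_U[symmetric] orthogonal_def)
  then have "y $ m = 0"
    using assms by simp
  moreover have "y \<bullet> y = y \<bullet> axis m 1 - y \<bullet> z"
    using zy(3) by (simp add: inner_add_right)
  moreover have "y \<bullet> z = 0"
    using zy(1,2) by (simp add: orthogonal_def)
  ultimately have "y = 0"
    by (simp add: inner_axis)
  then obtain a where a: "axis m 1 = U a"
    using zy by auto
  show thesis
  proof (rule that)
    show "a \<bullet> u i = (if i = m then 1 else 0)" for i
      using arg_cong[OF a, of "\<lambda>v. v $ i"] by (simp add: U_def axis_def eq_commute)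
  qed
qed

lemma rank_eq_CARD_mult_eq_0:
  fixes P :: "real^'r^'n"
  assumes "rank P = CARD('r)" "P *v x = 0"
  shows "x = 0"
  using assms full_rank_injective[of P] by (metis injD matrix_vector_mult_0_right)

text \<open>Row m of S is the unique solution s of P^T P s = P_m. A dual vector solves this too: P a
  = e_m + (c . a) e, and P^T e = 0 removes the effect of the shift by \<open>c\<close>.\<close>

lemma row_S_mat_eqI:
  fixes P :: "real^'r^'n"
  assumes rk: "rank P = CARD('r)" and P0: "(\<Sum>i\<in>UNIV. P $ i) = 0"
    and a: "\<And>i. a \<bullet> (P $ i - c) = (if i = m then 1 else 0)"
  shows "S_mat P $ m = a"
proof -
  define M where "M = transpose P ** P"
  have M_inj: "x = 0" if "M *v x = 0" for x
  proof -
    have "(P *v x) \<bullet> (P *v x) = x \<bullet> (M *v x)"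
      by (simp add: M_def matrix_vector_mul_assoc[symmetric] dot_lmul_matrix[symmetric]
          vector_transpose_matrix inner_commute)
    then have "P *v x = 0"
      using that by simp
    then show ?thesis
      using rank_eq_CARD_mult_eq_0[OF rk] by blast
  qed
  then have "invertible M"
    by (metis invertible_left_inverse matrix_left_invertible_ker)
  then have "matrix_inv M ** M = mat 1"
    unfolding invertible_def matrix_inv_def by (rule someI2_ex) simp
  then have "S_mat P ** M = P"
    by (simp add: S_mat_def M_def[symmetric] matrix_mul_assoc[symmetric])
  moreover have "transpose M = M"
    by (simp add: M_def matrix_transpose_mul)
  moreover have "(S_mat P ** M) $ m = transpose M *v (S_mat P $ m)"
    by (simp add: vec_eq_iff matrix_matrix_mult_def vector_matrix_mult_def mult.commute)
  ultimately have "M *v (S_mat P $ m) = P $ m"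
    by metis
  moreover have "M *v a = P $ m"
  proof -
    have "M *v a = (\<Sum>i\<in>UNIV. (P $ i \<bullet> a) *\<^sub>R P $ i)"
      by (simp add: M_def matrix_vector_mul_assoc[symmetric] transpose_mult_eq_sum_rows
          matrix_vector_mul_component del: transpose_matrix_vector)
    also have "\<dots> = (\<Sum>i\<in>UNIV. (if i = m then P $ i else 0) + (c \<bullet> a) *\<^sub>R P $ i)"
    proof (rule sum.cong)
      fix i
      have "P $ i \<bullet> a = (if i = m then 1 else 0) + c \<bullet> a"
        using a[of i] by (simp add: inner_diff_right inner_commute)
      then show "(P $ i \<bullet> a) *\<^sub>R P $ i = (if i = m then P $ i else 0) + (c \<bullet> a) *\<^sub>R P $ i"
        by (simp add: algebra_simps)
    qed simp
    also have "\<dots> = P $ m"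
      by (simp add: sum.distrib scaleR_sum_right[symmetric] P0)
    finally show ?thesis .
  qed
  ultimately have "M *v (S_mat P $ m - a) = 0"
    by (simp add: matrix_vector_mult_diff_distrib)
  then show ?thesis
    using M_inj by fastforce
qed

section \<open>The kernel of U^T\<close>

text \<open>
  With \<open>D = 2 (e e\<^sup>T - U U\<^sup>T)\<close> and \<open>\<mu>\<close> the barycentric coordinates of the centre, \<open>D \<mu> = 2 e\<close>. So e
  lies in the range of D, hence \<open>D w = e\<close>.
\<close>

lemma pinv_ones_kernel:
  fixes u :: "'n::finite \<Rightarrow> 'a::euclidean_space" and \<mu> :: "real^'n"
  assumes D: "generates D u" and u1: "\<And>i. norm (u i) = 1"
    and \<mu>: "(\<Sum>i\<in>UNIV. \<mu> $ i) = 1" "(\<Sum>i\<in>UNIV. \<mu> $ i *\<^sub>R u i) = 0"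
    and w: "w = pinv D *v ones"
  shows "(\<Sum>i\<in>UNIV. w $ i *\<^sub>R u i) = 0" "(\<Sum>i\<in>UNIV. w $ i) = 1 / 2"
proof -
  have Dx: "(D *v x) $ i = 2 * (\<Sum>j\<in>UNIV. x $ j) - 2 * (u i \<bullet> (\<Sum>j\<in>UNIV. x $ j *\<^sub>R u j))" for x i
  proof -
    have "u i \<bullet> u i = 1" for i
      using u1[of i] by (simp add: norm_eq_1)
    then have "D $ i $ j = 2 - 2 * (u i \<bullet> u j)" for j
      using D by (simp add: generates_def dist_norm power2_norm_eq_inner inner_diff_left
          inner_diff_right inner_commute)
    then show ?thesis
      by (simp add: matrix_vector_mult_def inner_sum_right left_diff_distrib right_diff_distrib
          sum_subtractf sum_distrib_left mult_ac)
  qed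
  have "D *v \<mu> = 2 *\<^sub>R ones"
    by (simp add: vec_eq_iff Dx ones_def \<mu>)
  then have "D *v ((1 / 2) *\<^sub>R \<mu>) = ones"
    by (simp add: matrix_vector_mult_scaleR)
  then have "D *v w = D ** pinv D ** D *v ((1 / 2) *\<^sub>R \<mu>)"
    by (metis w matrix_vector_mul_assoc)
  also have "\<dots> = D *v ((1 / 2) *\<^sub>R \<mu>)"
    using is_pinv_pinv[of D] by (simp add: is_pinv_def)
  also have "\<dots> = ones"
    by fact
  finally have "D *v w = ones" .
  then have eq: "2 * (\<Sum>j\<in>UNIV. w $ j) - 2 * (u i \<bullet> (\<Sum>j\<in>UNIV. w $ j *\<^sub>R u j)) = 1" for i
    using Dx[of w i] by (simp add: ones_def)
  let ?s = "\<Sum>j\<in>UNIV. w $ j" and ?v = "\<Sum>j\<in>UNIV. w $ j *\<^sub>R u j"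
  have "u i \<bullet> ?v = ?s - 1 / 2" for i
    using eq[of i] by linarith
  \<comment> \<open>Taking \<open>x = \<mu>\<close> makes the left side 0 and yields the value of
    \<open>?s\<close>; taking \<open>x = w\<close> then shows that \<open>?v\<close> has norm
    0.\<close>
  then have comb: "(\<Sum>i\<in>UNIV. x $ i *\<^sub>R u i) \<bullet> ?v = (\<Sum>i\<in>UNIV. x $ i) * (?s - 1 / 2)" for x :: "real^'n"
    by (simp add: inner_sum_left sum_distrib_right)
  show s: "?s = 1 / 2"
    using comb[of \<mu>] \<mu> by simp
  show "?v = 0"
    using comb[of w] s by simp
qed

text \<open>Affine relations among generating points depend only on \<open>D\<close>, so
  \<open>x\<close> is also a relation for the points \<open>P'\<close> of the Gale matrix. It
  therefore lies in the column span of \<open>Z\<close>, where all m-th coordinates vanish.\<close>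

lemma gale_matrix_kernel:
  fixes x :: "real^'n"
  assumes gale: "gale_matrix D P' Z" and P: "generates D P"
    and x: "(\<Sum>i\<in>UNIV. x $ i) = 0" "(\<Sum>i\<in>UNIV. x $ i *\<^sub>R P i) = 0" and m: "Z $ m = 0"
  shows "x $ m = 0"
proof -
  have P': "generates D (\<lambda>i. P' $ i)"
    and Z: "span (columns Z) = {x. transpose P' *v x = 0 \<and> ones \<bullet> x = 0}"
    using gale by (auto simp: gale_matrix_def)
  have comb: "comb q a x = (\<Sum>i\<in>UNIV. x $ i *\<^sub>R q i)" for q :: "'n \<Rightarrow> 'z::euclidean_space" and a
    using x(1) by (simp add: comb_def scaleR_diff_right sum_subtractf scaleR_sum_left[symmetric])
  have "norm (\<Sum>i\<in>UNIV. x $ i *\<^sub>R P' $ i) = 0"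
    using norm_comb_eq[OF P' P, of _ x] x(2) by (simp add: comb)
  then have "x \<in> span (columns Z)"
    using x(1) by (simp add: Z transpose_mult_eq_sum_rows ones_def inner_vec_def
        del: transpose_matrix_vector)
  also have "span (columns Z) \<subseteq> {v. v $ m = 0}"
  proof (rule span_minimal)
    show "columns Z \<subseteq> {v. v $ m = 0}"
      using m by (auto simp: columns_def column_def)
  qed (simp add: subspace_def)
  finally show ?thesis
    by simp
qed

text \<open>The kernel of P^T, here \<open>N\<close>, has dimension n - r <= 1 and contains e,
  because the points are centred. It also contains \<open>x\<close>, which is orthogonal to
  e.\<close>

lemma full_dim_kernel:
  fixes P :: "real^'r^'n" and x :: "real^'n"
  assumes "rank P = CARD('r)" "CARD('n) \<le> CARD('r) + 1" "(\<Sum>i\<in>UNIV. P $ i) = 0"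
    and x: "(\<Sum>i\<in>UNIV. x $ i) = 0" "(\<Sum>i\<in>UNIV. x $ i *\<^sub>R P $ i) = 0"
  shows "x = 0"
proof (rule ccontr)
  assume "x \<noteq> 0"
  define R where "R = range ((*v) P)"
  define N where "N = {y. \<forall>v\<in>R. orthogonal v y}"
  have "subspace R"
    unfolding R_def by (intro linear_subspace_image matrix_vector_mul_linear subspace_UNIV)
  then have "dim N + dim R = CARD('n)"
    using dim_subspace_orthogonal_to_vectors[of R UNIV] by (simp add: N_def)
  moreover have "dim R = CARD('r)"
    using assms(1) by (simp add: R_def rank_dim_range)
  ultimately have "dim N \<le> 1"
    using assms(2) by linarith
  have N: "y \<in> N" if "(\<Sum>i\<in>UNIV. y $ i *\<^sub>R P $ i) = 0" for y
  proof -
    have "(P *v v) \<bullet> y = v \<bullet> (\<Sum>i\<in>UNIV. y $ i *\<^sub>R P $ i)" for v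
    proof -
      have "(P *v v) \<bullet> y = (\<Sum>i\<in>UNIV. (P $ i \<bullet> v) * y $ i)"
        by (simp add: inner_vec_def[of "P *v v"] matrix_vector_mul_component)
      then show ?thesis
        by (simp add: inner_sum_right inner_commute mult.commute)
    qed
    then show ?thesis
      using that by (auto simp: N_def R_def orthogonal_def)
  qed
  have "{ones, x} \<subseteq> N"
    using x(2) assms(3) by (auto intro!: N simp: ones_def)
  moreover have "orthogonal ones x"
    using x(1) by (simp add: orthogonal_def ones_def inner_vec_def)
  moreover have "ones \<noteq> (0 :: real^'n)"
    by (simp add: ones_def vec_eq_iff)
  ultimately have "pairwise orthogonal {ones, x}" "0 \<notin> {ones, x}" "ones \<noteq> x"
    using \<open>x \<noteq> 0\<close> by (auto simp: pairwise_def orthogonal_commute orthogonal_self)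
  then have "independent {ones, x}" "card {ones, x} = 2"
    by (simp_all add: pairwise_orthogonal_independent)
  then have "2 \<le> dim N"
    using \<open>{ones, x} \<subseteq> N\<close> independent_card_le_dim by metis
  with \<open>dim N \<le> 1\<close> show False
    by simp
qed

section \<open>From the hypotheses on \<open>w\<close> and \<open>Z\<close> to dual vectors\<close>

text \<open>The hypotheses on \<open>Z\<close> are conditional because a Gale matrix exists only for
  r <= n - 2; \<open>P'\<close> lets it come from generating points other than the centred ones in
  \<open>P\<close>. A unit sphere forces r >= 1, so the nonempty index type \<open>'r\<close> loses
  no case.\<close>

theorem theorem3p2:
  fixes D :: "real^'n^'n" and P P' S :: "real^'r^'n" and Z :: "real^'m^'n"
    and w :: "real^'n" and k l :: 'n
  assumes "unit_spherical_edm D"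
    and "embedding_dim D = int CARD('r)"
    and "k \<noteq> l"
    and "B_mat D = P ** transpose P" and "rank P = CARD('r)"
    and "S = S_mat P"
    and "w = pinv D *v ones"
    and "CARD('r) + 2 \<le> CARD('n) \<Longrightarrow> gale_matrix D P' Z"
    and "w $ k = 0" and "w $ l = 0"
    and "CARD('r) + 2 \<le> CARD('n) \<Longrightarrow> Z $ k = 0 \<and> Z $ l = 0"
  shows "T_le D k l = {2 / (S $ k \<bullet> S $ l - norm (S $ k) * norm (S $ l)) ..
                       2 / (S $ k \<bullet> S $ l + norm (S $ k) * norm (S $ l))}"
proof -
  have "edm D"
    using assms(1) by (auto simp: spherical_edm_def edm_def)
  note P = generates_of_B_mat[OF this assms(4)]
  obtain c where c: "c \<in> affine hull (range (($) P))" "\<And>i. dist c (P $ i) = 1"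
    using assms(1) spherical_edm_iff[OF P(1)] by auto
  define u where "u i = P $ i - c" for i
  have Du: "generates D u"
    using P(1) by (simp add: u_def generates_def dist_norm)
  have u1: "norm (u i) = 1" for i
    using c(2)[of i] by (simp add: u_def dist_norm norm_minus_commute)
  have sum_u: "(\<Sum>i\<in>UNIV. x $ i *\<^sub>R u i) = (\<Sum>i\<in>UNIV. x $ i *\<^sub>R P $ i) - (\<Sum>i\<in>UNIV. x $ i) *\<^sub>R c"
    for x :: "real^'n"
    by (simp add: u_def scaleR_diff_right sum_subtractf scaleR_sum_left)
  obtain \<mu> :: "real^'n" where \<mu>: "(\<Sum>i\<in>UNIV. \<mu> $ i) = 1" "(\<Sum>i\<in>UNIV. \<mu> $ i *\<^sub>R u i) = 0"
  proof -
    obtain x where x: "c = P $ k + comb (($) P) k x"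
      using c(1) by (auto simp: affine_hull_comb[of "($) P" k])
    \<comment> \<open>Putting the missing weight on index k turns the expansion of \<open>c\<close>
      around \<open>P $ k\<close> into barycentric coordinates.\<close>
    define \<mu> where "\<mu> = x + (1 - (\<Sum>i\<in>UNIV. x $ i)) *\<^sub>R axis k 1"
    have ax: "(\<Sum>i\<in>UNIV. axis k 1 $ i *\<^sub>R v i) = v k" for v :: "'n \<Rightarrow> 'z::real_vector"
      by (simp add: axis_def if_distrib[of "\<lambda>r. r *\<^sub>R _"] cong: if_cong)
    have "(\<Sum>i\<in>UNIV. \<mu> $ i) = 1"
      using ax[of "\<lambda>_. 1 :: real"] by (simp add: \<mu>_def sum.distrib sum_distrib_left[symmetric])
    moreover have "(\<Sum>i\<in>UNIV. \<mu> $ i *\<^sub>R P $ i) = c"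
      using ax[of "($) P"] unfolding x comb_def
      by (simp add: \<mu>_def sum.distrib scaleR_left_distrib scaleR_diff_right sum_subtractf
          scaleR_sum_left[symmetric] scaleR_scaleR[symmetric] scaleR_sum_right[symmetric]
          scaleR_left_diff_distrib del: scaleR_scaleR)
    ultimately show thesis
      using that[of \<mu>] by (simp add: sum_u)
  qed
  note w = pinv_ones_kernel[OF Du u1 \<mu> assms(7)]
  have kernel: "x $ m = 0" if x: "(\<Sum>i\<in>UNIV. x $ i *\<^sub>R u i) = 0" and m: "m = k \<or> m = l"
    for x :: "real^'n" and m
  proof -
    \<comment> \<open>The entries of \<open>w\<close> sum to 1/2, so the factor 2 makes those of
      \<open>y\<close> sum to 0. Thus \<open>y\<close> is an affine relation among the
      points.\<close>
    define y where "y = x - (2 * (\<Sum>i\<in>UNIV. x $ i)) *\<^sub>R w"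
    have y0: "(\<Sum>i\<in>UNIV. y $ i) = 0"
      using w(2) by (simp add: y_def sum_subtractf sum_distrib_left[symmetric])
    have "(\<Sum>i\<in>UNIV. y $ i *\<^sub>R u i) = 0"
      using w(1) x by (simp add: y_def sum_subtractf scaleR_left_diff_distrib
          scaleR_sum_right[symmetric] scaleR_scaleR[symmetric] del: scaleR_scaleR)
    then have yP: "(\<Sum>i\<in>UNIV. y $ i *\<^sub>R P $ i) = 0"
      using y0 by (simp add: sum_u)
    \<comment> \<open>The Gale matrix handles r <= n - 2; otherwise n <= r + 1 and there is no
      nonzero affine relation.\<close>
    have "y $ m = 0"
    proof (cases "CARD('r) + 2 \<le> CARD('n)")
      case True
      then show ?thesis
        using gale_matrix_kernel[OF assms(8) P(1) y0 yP] assms(11) m by blast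
    next
      case False
      then show ?thesis
        using full_dim_kernel[OF assms(5) _ P(2) y0 yP] by simp
    qed
    then show ?thesis
      using m assms(9,10) by (auto simp: y_def)
  qed
  \<comment> \<open>Since relations among the \<open>u i\<close> vanish at m, a dual vector exists,
    and it must be the row of \<open>S\<close>.\<close>
  have S: "S $ m \<bullet> u i = (if i = m then 1 else 0)" if m: "m = k \<or> m = l" for m i
  proof -
    obtain a where a: "\<And>i. a \<bullet> u i = (if i = m then 1 else 0)"
      using dual_vector_exists[of u m] kernel[OF _ m] by blast
    then have "S $ m = a"
      using row_S_mat_eqI[OF assms(5) P(2)] unfolding assms(6) u_def by blast
    with a show ?thesis
      by simp
  qed
  \<comment> \<open>A vector orthogonal to all \<open>u i\<close> has the same inner product with
    \<open>c\<close> and with every row of \<open>P\<close>. The rows sum to 0, so this value is 0,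
    and full column rank makes the vector 0.\<close>
  have "y \<in> span (range u)" for y
  proof -
    obtain y1 y2 where y: "y1 \<in> span (range u)" "\<And>v. v \<in> span (range u) \<Longrightarrow> orthogonal y2 v" "y = y1 + y2"
      using orthogonal_subspace_decomp_exists[of "range u" y] by metis
    have Py: "P $ i \<bullet> y2 = c \<bullet> y2" for i
      using y(2)[OF span_base, of "u i"]
      by (simp add: orthogonal_def u_def inner_diff_right inner_commute)
    have "(\<Sum>i\<in>UNIV. P $ i) \<bullet> y2 = real CARD('n) * (c \<bullet> y2)"
      by (simp add: inner_sum_left Py)
    then have "c \<bullet> y2 = 0"
      by (simp add: P(2))
    then have "P *v y2 = 0"
      by (simp add: vec_eq_iff matrix_vector_mul_component Py)
    then have "y2 = 0"
      by (rule rank_eq_CARD_mult_eq_0[OF assms(5)])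
    then show ?thesis
      using y(1,3) by simp
  qed
  then show ?thesis
    using T_le_dual_vectors[OF Du u1 _ assms(3) S S] by auto
qed

end
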